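(* Let $k\ge 1$ be an integer and let $d_1\ge d_2\ge\cdots\ge d_n$ be the degree sequence of a connected $k$-threshold hypergraph $G$ (constructed with at least one domination). Let $D_i$ be the width of the $i$-th block from above and $C_i$ the $i$-th column sum from the left in the Ferrer's diagram of the degree sequence, and let $d=\min\{s\in\mathbb{N}: D_s<s\}-1$. Then the complete list of eigenvalues of the Laplacian $L_G$ is as follows: (i) $0$ with multiplicity $1$; (ii) $\frac1k C_{D_i}$ with multiplicity $D_i-D_{i+1}-k+1$, for each $i=1,\ldots,d-1$; (iii) $\frac1k C_{D_d}$ with multiplicity $D_d-D_{d+1}$, if $D_d\neq d$; (iv) $\frac1k C_i$ with multiplicity $1$, for each $i=1,\ldots,d$; (v) $\frac1k\left[(k+1)D_i-i+1\right]$ with multiplicity $k-1$, for each $i=1,\ldots,d$.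
   Context: A (finite) hypergraph $G=(V,E)$ consists of a nonempty finite vertex set $V$ and a set $E$ of subsets of $V$ (hyperedges), with $|e|\ge 2$ for all $e\in E$. For $v\in V$ let $E_v=\{e\in E: v\in e\}$; the degree of $v$ is $|E_v|$. The Laplacian $L_G:\mathbb{R}^V\to\mathbb{R}^V$ is $$(L_Gf)(v)=\sum_{e\in E_v}\frac{1}{|e|-1}\sum_{u\in e}\bigl(f(v)-f(u)\bigr),\qquad v\in V.$$ For a positive integer $k$, applying $k$-domination to a hypergraph $(V,E)$ means adding a set $S$ of $k$ new vertices ($S\cap V=\emptyset$), producing the hypergraph with vertex set $V\cup S$ and hyperedge set $E\cup\{S\cup\{v\}: v\in V\}$. Adding an isolated vertex means adding one new vertex without changing the hyperedge set. A $k$-threshold hypergraph is a hypergraph obtained from a single vertex by repeatedly adding an isolated vertex or applying $k$-domination, with the same fixed $k$ in every domination. A connected $k$-threshold hypergraph with at least one domination is one whose construction ends with a $k$-domination. The Ferrer's diagram of a non-increasing sequence $d_1\ge\cdots\ge d_n$ of non-negative integers consists of $n$ left-justified rows of boxes, the $i$-th row from above having $d_i$ boxes. A block is the collection of all rows with the same number of boxes; its width is the number of boxes in each of its rows. Thus $D_1>D_2>\cdots$ are the distinct values of the degree sequence in decreasing order, and $D_s=0$ by convention if $s$ exceeds the number of blocks. The $i$-th column sum $C_i$ is the number of boxes in the $i$-th column, i.e. $C_i=|\{j: d_j\ge i\}|$. Here $\mathbb{N}=\{1,2,\dots\}$. The list of eigenvalues is to be read as a multiset: equal values occurring in different items have their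 multiplicities added, and multiplicity $0$ means the value is not contributed by that item.
   Formalization: For k=1 the list fails for some graphs (e.g. the triangle: four eigenvalues for three vertices); it is proved as stated for k≥2, for k=1 exactly when D_d=d or D_{d+1}=d (where it holds), and for all k=1 graphs with each row counted as its own block. *)

theory Defs
  imports "HOL-Analysis.Analysis" "HOL-Library.Function_Algebras" "HOL-Library.Multiset"
begin

section \<open>Hypergraphs and their Laplacian\<close>

text \<open>A hypergraph is given by its vertex set and its hyperedge set.\<close>

definition hypergraph :: "'a set \<Rightarrow> 'a set set \<Rightarrow> bool" where
  "hypergraph V E \<longleftrightarrow> finite V \<and> V \<noteq> {} \<and> (\<forall>e\<in>E. e \<subseteq> V \<and> card e \<ge> 2)"

definition incident_edges :: "'a set set \<Rightarrow> 'a \<Rightarrow> 'a set set" where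
  "incident_edges E v = {e \<in> E. v \<in> e}"

definition degree :: "'a set set \<Rightarrow> 'a \<Rightarrow> nat" where
  "degree E v = card (incident_edges E v)"

definition laplacian :: "'a set set \<Rightarrow> ('a \<Rightarrow> real) \<Rightarrow> 'a \<Rightarrow> real" where
  "laplacian E f v =
     (\<Sum>e\<in>incident_edges E v. 1 / (real (card e) - 1) * (\<Sum>u\<in>e. f v - f u))"

text \<open>The space of real functions on \<open>V\<close> is represented by the functions on the whole type that
  vanish outside \<open>V\<close>.  For a hypergraph on \<open>V\<close> the Laplacian maps this space into itself, since
  \<open>incident_edges E v\<close> is empty for \<open>v\<close> outside \<open>V\<close>.\<close>

global_interpretation fun_vs: vector_space "\<lambda>(c::real) (f :: 'a \<Rightarrow> real) x. c * f x"
  defines fun_dim = fun_vs.dim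
  by unfold_locales (auto simp: fun_eq_iff algebra_simps)

definition eigenspace :: "'a set \<Rightarrow> (('a \<Rightarrow> real) \<Rightarrow> 'a \<Rightarrow> real) \<Rightarrow> real \<Rightarrow> ('a \<Rightarrow> real) set" where
  "eigenspace V T x = {f. (\<forall>v. v \<notin> V \<longrightarrow> f v = 0) \<and> (\<forall>v\<in>V. T f v = x * f v)}"

text \<open>The list is complete: every real number occurs with its multiplicity as an eigenvalue, and the
  multiplicities add up to the dimension of the space.  Hence \<open>T\<close> is diagonalizable over the reals,
  there is no further (complex) eigenvalue, and algebraic and geometric multiplicities agree.\<close>

definition complete_eigenvalue_list ::
    "'a set \<Rightarrow> (('a \<Rightarrow> real) \<Rightarrow> 'a \<Rightarrow> real) \<Rightarrow> real multiset \<Rightarrow> bool" where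
  "complete_eigenvalue_list V T M \<longleftrightarrow>
     (\<forall>x. fun_dim (eigenspace V T x) = count M x) \<and> size M = card V"

section \<open>Threshold hypergraphs\<close>

definition dominated_edges :: "'a set \<Rightarrow> 'a set \<Rightarrow> 'a set set \<Rightarrow> 'a set set" where
  "dominated_edges S V E = E \<union> {S \<union> {v} | v. v \<in> V}"

inductive threshold_hypergraph :: "nat \<Rightarrow> 'a set \<Rightarrow> 'a set set \<Rightarrow> bool" for k :: nat where
  single: "threshold_hypergraph k {v} {}"
| isolated: "threshold_hypergraph k V E \<Longrightarrow> v \<notin> V \<Longrightarrow> threshold_hypergraph k (insert v V) E"
| domination: "threshold_hypergraph k V E \<Longrightarrow> finite S \<Longrightarrow> card S = k \<Longrightarrow> S \<inter> V = {} \<Longrightarrow>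
    threshold_hypergraph k (V \<union> S) (dominated_edges S V E)"

definition connected_threshold_hypergraph :: "nat \<Rightarrow> 'a set \<Rightarrow> 'a set set \<Rightarrow> bool" where
  "connected_threshold_hypergraph k V E \<longleftrightarrow>
     (\<exists>V' E' S. threshold_hypergraph k V' E' \<and> finite S \<and> card S = k \<and> S \<inter> V' = {} \<and>
        V = V' \<union> S \<and> E = dominated_edges S V' E')"

lemma threshold_hypergraph_is_hypergraph:
  assumes "k \<ge> 1" and "threshold_hypergraph k V E"
  shows "hypergraph V E"
  using assms(2)
proof induction
  case (domination V E S)
  have "card (insert v S) \<ge> 2" if "v \<in> V" for v
  proof -
    have "v \<notin> S" using domination.hyps that by auto
    then show ?thesis using domination.hyps assms(1) by simp
  qed
  then show ?case
    using domination by (auto simp: hypergraph_def dominated_edges_def)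
qed (auto simp: hypergraph_def)

section \<open>The Ferrer's diagram\<close>

definition degree_sequence :: "'a set \<Rightarrow> 'a set set \<Rightarrow> nat list" where
  "degree_sequence V E = rev (sorted_list_of_multiset (image_mset (degree E) (mset_set V)))"

text \<open>Rows, blocks and columns are counted from 1.\<close>

definition row_length :: "nat list \<Rightarrow> nat \<Rightarrow> nat" where
  "row_length ds s = (if 1 \<le> s \<and> s \<le> length ds then ds ! (s - 1) else 0)"

definition block_width :: "nat list \<Rightarrow> nat \<Rightarrow> nat" where
  "block_width ds = row_length (rev (sorted_list_of_set (set ds)))"

definition column_sum :: "nat list \<Rightarrow> nat \<Rightarrow> nat" where
  "column_sum ds i = card {j. j < length ds \<and> i \<le> ds ! j}"

definition durfee :: "(nat \<Rightarrow> nat) \<Rightarrow> nat" where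
  "durfee D = (LEAST s. s \<ge> 1 \<and> D s < s) - 1"

text \<open>\<open>D\<close> is the sequence of block widths and \<open>C\<close> that of column sums.  The first multiplicity is
  computed over the integers because a subtraction on the naturals would truncate.\<close>

definition ferrers_eigenvalues :: "nat \<Rightarrow> (nat \<Rightarrow> nat) \<Rightarrow> (nat \<Rightarrow> nat) \<Rightarrow> real multiset" where
  "ferrers_eigenvalues k C D = (let d = durfee D in
     {#0#}
     + (\<Sum>i\<in>{1..<d}. replicate_mset (nat (int (D i) - int (D (i + 1)) - int k + 1))
                         (1 / real k * real (C (D i))))
     + (if D d \<noteq> d then replicate_mset (D d - D (d + 1)) (1 / real k * real (C (D d))) else {#})
     + (\<Sum>i\<in>{1..d}. replicate_mset 1 (1 / real k * real (C i)))
     + (\<Sum>i\<in>{1..d}. replicate_mset (k - 1)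
                         (1 / real k * ((real k + 1) * real (D i) - real i + 1))))"

text \<open>For \<open>k \<ge> 2\<close> different dominations create vertices of different degrees.  For \<open>k = 1\<close> they need
  not: two successive dominations create two vertices of equal degree, whose rows then lie in one
  block, and the multiplicities in \<^const>\<open>ferrers_eigenvalues\<close>, taken with \<open>D\<close> the sequence of block
  widths, need not add up to the number of vertices (for the triangle, with degrees 2, 2, 2, they
  add up to 4).  For \<open>k = 1\<close> they do so exactly if the following predicate holds.  No such
  restriction is needed for \<open>k = 1\<close> if every row is regarded as a block of its own, that is, if \<open>D\<close>
  is the sequence of row lengths.\<close>

definition durfee_tight :: "(nat \<Rightarrow> nat) \<Rightarrow> bool" where
  "durfee_tight D \<longleftrightarrow> D (durfee D) = durfee D \<or> D (durfee D + 1) = durfee D"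

end

theory Submission
  imports Defs
begin

text \<open>A domination is transparent to the functions with sum zero.  Let \<open>V\<close> have \<open>n\<close> elements and add
  a dominating set \<open>S\<close> of size \<open>k\<close>.  A zero-sum eigenfunction on \<open>V\<close> with eigenvalue \<open>x\<close>, extended
  by zero, has eigenvalue \<open>x + 1\<close> afterwards.  The zero-sum functions on \<open>S\<close> have eigenvalue
  \<open>(k + 1) n / k\<close>, and the function with value \<open>k\<close> on \<open>V\<close> and \<open>-n\<close> on \<open>S\<close> has eigenvalue
  \<open>n / k + 1\<close> (lemma \<open>eigenvectors_in_dominated\<close>).  An isolated vertex only adds an eigenvalue \<open>0\<close>
  (\<open>eigenvectors_in_isolated\<close>).  So the zero-sum spectrum can be read off from the numbers \<open>n\<^sub>i\<close> of
  vertices present before the \<open>i\<close>-th domination from the end, \<open>1 \<le> i \<le> r\<close>, where \<open>n\<^sub>0\<close> is the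
  final number of vertices: it consists of \<open>i\<close> for every isolated vertex followed by exactly
  \<open>i < r\<close> dominations, \<open>r\<close> with multiplicity \<open>n\<^sub>r - 1\<close>, and, for \<open>1 \<le> i \<le> r\<close>, \<open>n\<^sub>i / k + i\<close> once and \<open>(k + 1) n\<^sub>i / k + i - 1\<close> with multiplicity
  \<open>k - 1\<close>.  The constant functions contribute the remaining \<open>0\<close>.

  The degrees are given by the same numbers.  The dominating vertices of the \<open>i\<close>-th domination from
  the end have degree \<open>n\<^sub>i + i - 1\<close>; these are the widths of the \<open>r\<close> upper blocks if \<open>k \<ge> 2\<close>, the
  lengths of the \<open>r\<close> upper rows if \<open>k = 1\<close>, and all of them are at least \<open>r\<close>.  Every other vertex has as degree the number of dominations
  after it.  Hence \<open>d = r\<close>, \<open>D\<^sub>i = n\<^sub>i + i - 1\<close> and \<open>C\<^sub>i = n\<^sub>i + k i\<close> for \<open>1 \<le> i \<le> r\<close>, and \<open>C\<close> at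
  \<open>D\<^sub>i\<close> is \<open>k i\<close> whenever that entry is used; substituting turns the list into the spectrum
  (\<open>ferrers_eigenvalues_profile\<close>).

  This argument covers the blocks for \<open>k \<ge> 2\<close> and the rows for \<open>k = 1\<close>.  For \<open>k = 1\<close> several
  dominating vertices may share a block.  But then the list, both for rows and for tight blocks, is a
  regrouping of \<open>0\<close> and all the column sums, each counted once, and so the two lists coincide
  (\<open>ferrers_eigenvalues_tight\<close>).\<close>

section \<open>Eigenvalue lists from independent eigenvectors\<close>

definition functions_on :: "'a set \<Rightarrow> ('a \<Rightarrow> real) set" where
  "functions_on V = {f. \<forall>v. v \<notin> V \<longrightarrow> f v = 0}"

definition zero_sum_functions_on :: "'a set \<Rightarrow> ('a \<Rightarrow> real) set" where
  "zero_sum_functions_on V = {f \<in> functions_on V. sum f V = 0}"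

text \<open>A list of eigenvalues is carried along as an independent family of eigenvectors, not as a list
  of eigenspace dimensions: the family can be extended one vector at a time, and coincidences
  between eigenvalues then need no attention until the family is a basis.\<close>

definition eigenvectors_in ::
    "('a \<Rightarrow> real) set \<Rightarrow> (('a \<Rightarrow> real) \<Rightarrow> 'a \<Rightarrow> real) \<Rightarrow> real multiset \<Rightarrow> bool" where
  "eigenvectors_in W T M \<longleftrightarrow>
     (\<exists>B l. finite B \<and> B \<subseteq> W \<and> fun_vs.independent B \<and>
        (\<forall>b\<in>B. \<forall>v. T b v = l b * b v) \<and> M = image_mset l (mset_set B))"

lemma subspace_zero_sum_functions_on: "fun_vs.subspace (zero_sum_functions_on V)"
  by (auto simp: fun_vs.subspace_def zero_sum_functions_on_def functions_on_def sum.distrib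
      simp flip: sum_distrib_left)

lemma eigenvectors_in_empty: "eigenvectors_in W T {#}"
  unfolding eigenvectors_in_def by (intro exI[of _ "{}"]) (auto simp: fun_vs.independent_empty)

text \<open>The criterion for independence that serves every time a vector is added: the old vectors lie
  in a subspace that misses the new one.\<close>

lemma eigenvectors_in_add:
  assumes "eigenvectors_in W T M" "fun_vs.subspace W" "W \<subseteq> W'" "f \<in> W'" "f \<notin> W"
    and eig: "\<And>v. T f v = x * f v"
  shows "eigenvectors_in W' T (add_mset x M)"
proof -
  obtain B l where B: "finite B" "B \<subseteq> W" "fun_vs.independent B"
      "\<forall>b\<in>B. \<forall>v. T b v = l b * b v" "M = image_mset l (mset_set B)"
    using assms(1) unfolding eigenvectors_in_def by blast
  have "f \<notin> fun_vs.span B"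
    using fun_vs.span_minimal[OF B(2) assms(2)] assms(5) by auto
  then have "fun_vs.independent (insert f B)"
    using B(3) by (rule fun_vs.independent_insertI)
  moreover have "f \<notin> B" using B(2) assms(5) by auto
  moreover have "image_mset (l(f := x)) (mset_set B) = image_mset l (mset_set B)"
    using \<open>f \<notin> B\<close> B(1) by (intro image_mset_cong) auto
  ultimately show ?thesis
    unfolding eigenvectors_in_def using B assms(3,4) eig
    by (intro exI[of _ "insert f B"] exI[of _ "l(f := x)"]) auto
qed

text \<open>A domination acts on the old zero-sum functions as a shift by \<open>1\<close>; the eigenvectors stay.\<close>

lemma eigenvectors_in_change:
  assumes "eigenvectors_in W T M" "W \<subseteq> W'"
    and "\<And>f v. f \<in> W \<Longrightarrow> T' f v = T f v + c * f v"
  shows "eigenvectors_in W' T' (image_mset (\<lambda>x. x + c) M)"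
proof -
  obtain B l where B: "finite B" "B \<subseteq> W" "fun_vs.independent B"
      "\<forall>b\<in>B. \<forall>v. T b v = l b * b v" "M = image_mset l (mset_set B)"
    using assms(1) unfolding eigenvectors_in_def by blast
  have "\<forall>b\<in>B. \<forall>v. T' b v = (l b + c) * b v"
    using B assms(3) by (auto simp: algebra_simps subset_iff)
  then show ?thesis
    unfolding eigenvectors_in_def using B assms(2)
    by (intro exI[of _ B] exI[of _ "\<lambda>b. l b + c"]) (auto simp: image_mset.compositionality o_def)
qed

lemma sum_fun_apply: "(\<Sum>a\<in>A. f a) x = (\<Sum>a\<in>A. f a x :: real)"
  by (induction A rule: infinite_finite_induct) auto

lemma functions_on_subset_span_indicators:
  assumes "finite V"
  shows "functions_on V \<subseteq> fun_vs.span ((\<lambda>v u. if u = v then 1 else 0) ` V)"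
proof
  fix f :: "'a \<Rightarrow> real" assume f: "f \<in> functions_on V"
  let ?e = "\<lambda>v u. if u = v then 1 else (0::real)"
  have "(\<Sum>v\<in>V. (\<lambda>u. f v * ?e v u)) \<in> fun_vs.span (?e ` V)"
    by (rule fun_vs.span_sum, rule fun_vs.span_scale, rule fun_vs.span_base, rule imageI)
  moreover have "(\<Sum>v\<in>V. (\<lambda>u. f v * ?e v u)) = f"
    using f assms by (auto simp: fun_eq_iff functions_on_def sum_fun_apply if_distrib cong: if_cong)
  ultimately show "f \<in> fun_vs.span (?e ` V)" by simp
qed

lemma functions_on_subset_span:
  assumes "finite V" "B \<subseteq> functions_on V" "fun_vs.independent B" "card V \<le> card B"
  shows "functions_on V \<subseteq> fun_vs.span B"
proof (rule subsetI, rule ccontr)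
  let ?I = "(\<lambda>v u. if u = v then 1 else (0::real)) ` V"
  fix f assume f: "f \<in> functions_on V" "f \<notin> fun_vs.span B"
  have "fun_vs.independent (insert f B)"
    using f(2) assms(3) by (rule fun_vs.independent_insertI)
  moreover have "insert f B \<subseteq> fun_vs.span ?I"
    using functions_on_subset_span_indicators[OF assms(1)] assms(2) f(1) by blast
  ultimately have "finite (insert f B)" "card (insert f B) \<le> card ?I"
    using fun_vs.independent_span_bound[of ?I "insert f B"] assms(1) by auto
  moreover have "f \<notin> B" using f(2) fun_vs.span_base by blast
  moreover have "card ?I \<le> card V" using assms(1) by (rule card_image_le)
  ultimately show False using assms(4) by simp
qed

text \<open>Independent eigenvectors as numerous as the vertices form a basis.  Comparing coefficients in
  \<open>T f = x f\<close> shows that the basis vectors with eigenvalue \<open>x\<close> span the eigenspace of \<open>x\<close>.\<close>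

lemma complete_eigenvalue_listI:
  assumes "finite V" and ev: "eigenvectors_in (functions_on V) T M" and "size M = card V"
    and lin: "\<And>c B v. finite B \<Longrightarrow> T (\<lambda>u. \<Sum>b\<in>B. c b * b u) v = (\<Sum>b\<in>B. c b * T b v)"
    and outside: "\<And>f v. v \<notin> V \<Longrightarrow> T f v = 0"
  shows "complete_eigenvalue_list V T M"
proof -
  obtain B l where B: "finite B" "B \<subseteq> functions_on V" "fun_vs.independent B"
      "\<forall>b\<in>B. \<forall>v. T b v = l b * b v" "M = image_mset l (mset_set B)"
    using ev unfolding eigenvectors_in_def by blast
  have span: "functions_on V \<subseteq> fun_vs.span B"
    using assms(1,3) B by (intro functions_on_subset_span) auto
  have "fun_dim (eigenspace V T x) = count M x" for x
  proof -
    let ?Bx = "{b \<in> B. l b = x}"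
    have "eigenspace V T x \<subseteq> fun_vs.span ?Bx"
    proof
      fix f assume f: "f \<in> eigenspace V T x"
      then have "f \<in> fun_vs.span B" using span by (auto simp: eigenspace_def functions_on_def)
      then obtain c where c: "f = (\<Sum>b\<in>B. (\<lambda>u. c b * b u))"
        using fun_vs.span_finite[OF B(1)] by auto
      then have c': "f = (\<lambda>u. \<Sum>b\<in>B. c b * b u)" by (simp add: fun_eq_iff sum_fun_apply)
      have Tf: "T f v = x * f v" for v
        using f outside[of v f] by (cases "v \<in> V") (auto simp: eigenspace_def)
      have "(\<Sum>b\<in>B. (\<lambda>u. (c b * (l b - x)) * b u)) = 0"
      proof
        fix u
        have "(\<Sum>b\<in>B. c b * (l b * b u)) = x * (\<Sum>b\<in>B. c b * b u)"
          using Tf[of u] lin[OF B(1), of c u] B(4) by (simp add: c')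
        then show "(\<Sum>b\<in>B. (\<lambda>u. (c b * (l b - x)) * b u)) u = 0 u"
          by (simp add: sum_fun_apply algebra_simps sum_subtractf sum_distrib_left)
      qed
      then have "c b * (l b - x) = 0" if "b \<in> B" for b
        using fun_vs.independentD[OF B(3) B(1) subset_refl _ that, of "\<lambda>b. c b * (l b - x)"] by simp
      then have f_eq: "f = (\<Sum>b\<in>?Bx. (\<lambda>u. c b * b u))"
        unfolding c using B(1) by (intro sum.mono_neutral_right) (auto simp: fun_eq_iff)
      show "f \<in> fun_vs.span ?Bx"
        unfolding f_eq
        by (rule fun_vs.span_sum, rule fun_vs.span_scale, rule fun_vs.span_base)
    qed
    moreover have "?Bx \<subseteq> eigenspace V T x"
      using B(2,4) by (auto simp: eigenspace_def functions_on_def)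
    moreover have "fun_vs.independent ?Bx"
      by (rule fun_vs.independent_mono[OF B(3)]) auto
    ultimately have "fun_dim (eigenspace V T x) = card ?Bx"
      by (intro fun_vs.dim_unique[OF _ _ _ refl])
    also have "\<dots> = (\<Sum>b | b \<in># mset_set B \<and> x = l b. count (mset_set B) b)"
      using B(1) by (simp add: eq_commute)
    also have "\<dots> = count M x"
      unfolding B(5) count_image_mset' ..
    finally show ?thesis .
  qed
  then show ?thesis using assms(3) by (simp add: complete_eigenvalue_list_def)
qed

section \<open>The Laplacian of a hypergraph\<close>

lemma laplacian_outside: "hypergraph V E \<Longrightarrow> v \<notin> V \<Longrightarrow> laplacian E f v = 0"
  by (auto simp: hypergraph_def laplacian_def incident_edges_def intro!: sum.neutral)

lemma laplacian_sum:
  "laplacian E (\<lambda>u. \<Sum>b\<in>B. c b * b u) v = (\<Sum>b\<in>B. c b * laplacian E b v)"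
proof -
  have "(\<Sum>u\<in>e. (\<Sum>b\<in>B. c b * b v) - (\<Sum>b\<in>B. c b * b u)) = (\<Sum>b\<in>B. c b * (\<Sum>u\<in>e. b v - b u))" for e
    unfolding sum_distrib_left by (subst sum.swap) (simp add: right_diff_distrib sum_subtractf)
  then have "laplacian E (\<lambda>u. \<Sum>b\<in>B. c b * b u) v =
      (\<Sum>e\<in>incident_edges E v. \<Sum>b\<in>B. c b * (1 / (real (card e) - 1) * (\<Sum>u\<in>e. b v - b u)))"
    by (simp add: laplacian_def sum_distrib_left mult.left_commute)
  also have "\<dots> = (\<Sum>b\<in>B. c b * laplacian E b v)"
    by (subst sum.swap) (simp add: laplacian_def sum_distrib_left)
  finally show ?thesis .
qed

text \<open>Every edge lies inside \<open>V\<close>, so only the values on \<open>V\<close> matter: this holds for \<open>v\<close> outside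
  \<open>V\<close> too, where the sum over incident edges is empty.\<close>

lemma laplacian_const:
  assumes "hypergraph V E" "\<And>u. u \<in> V \<Longrightarrow> f u = c"
  shows "laplacian E f v = 0"
proof -
  have "(\<Sum>u\<in>e. f v - f u) = 0" if "e \<in> incident_edges E v" for e
    using assms that by (intro sum.neutral) (auto simp: hypergraph_def incident_edges_def subset_iff)
  then show ?thesis by (simp add: laplacian_def)
qed

section \<open>The effect of domination and of isolated vertices\<close>

context
  fixes V S :: "'a set" and E :: "'a set set" and k :: nat
  assumes hyp: "hypergraph V E" and S: "finite S" "card S = k" "S \<inter> V = {}" and k: "k \<ge> 1"
begin

lemma dominating_set_nonempty: "S \<noteq> {}"
  using S k by auto

lemma new_edge_not_old: "S \<union> {v} \<notin> E"
proof
  assume "S \<union> {v} \<in> E"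
  then have "S \<subseteq> V" using hyp by (auto simp: hypergraph_def)
  then show False using S dominating_set_nonempty by auto
qed

lemma incident_edges_dominated_old:
  assumes "v \<in> V"
  shows "incident_edges (dominated_edges S V E) v = insert (S \<union> {v}) (incident_edges E v)"
  using assms S by (auto simp: incident_edges_def dominated_edges_def)

lemma incident_edges_dominated_new:
  assumes "s \<in> S"
  shows "incident_edges (dominated_edges S V E) s = (\<lambda>v. S \<union> {v}) ` V"
  using assms S hyp by (auto simp: incident_edges_def dominated_edges_def hypergraph_def)

lemma inj_new_edge: "inj_on (\<lambda>v. S \<union> {v}) V"
  using S(3) by (auto simp: inj_on_def)

lemma finite_incident: "finite (incident_edges E v)"
proof -
  have "incident_edges E v \<subseteq> Pow V"
    using hyp by (auto simp: incident_edges_def hypergraph_def)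
  then show ?thesis using hyp by (auto simp: hypergraph_def intro: finite_subset)
qed

lemma degree_dominated_old: "v \<in> V \<Longrightarrow> degree (dominated_edges S V E) v = Suc (degree E v)"
  using finite_incident new_edge_not_old[of v]
  by (simp add: degree_def incident_edges_dominated_old)
     (subst card_insert_disjoint; simp add: incident_edges_def)

lemma degree_dominated_new: "s \<in> S \<Longrightarrow> degree (dominated_edges S V E) s = card V"
  by (simp only: degree_def incident_edges_dominated_new card_image[OF inj_new_edge])

lemma card_new_edge: "v \<in> V \<Longrightarrow> card (S \<union> {v}) = Suc k"
  using S by (subst card_Un_disjoint) auto

text \<open>An old vertex \<open>v\<close> gains the single edge \<open>S \<union> {v}\<close>, of size \<open>k + 1\<close>.\<close>

lemma laplacian_dominated_old:
  assumes "v \<in> V"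
  shows "laplacian (dominated_edges S V E) f v = laplacian E f v + (real k * f v - sum f S) / real k"
proof -
  have "(\<Sum>u\<in>S \<union> {v}. f v - f u) = (\<Sum>u\<in>S. f v - f u)"
    using S assms by (subst sum.union_disjoint) auto
  moreover have "S \<union> {v} \<notin> incident_edges E v"
    using new_edge_not_old by (simp add: incident_edges_def)
  ultimately show ?thesis
    using finite_incident[of v] assms card_new_edge[of v] S
    by (simp add: laplacian_def incident_edges_dominated_old del: Un_insert_right)
       (simp add: sum_subtractf)
qed

text \<open>A vertex of \<open>S\<close> lies in exactly the edges \<open>S \<union> {v}\<close>, one for each old vertex \<open>v\<close>.\<close>

lemma laplacian_dominated_new:
  assumes "s \<in> S"
  shows "laplacian (dominated_edges S V E) f s =
    (real (card V) * ((real k + 1) * f s - sum f S) - sum f V) / real k"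
proof -
  define A where "A = (real k + 1) * f s - sum f S"
  have *: "(\<Sum>u\<in>S \<union> {v}. f s - f u) = A - f v" if "v \<in> V" for v
    unfolding A_def using S that by (subst sum.union_disjoint) (auto simp: sum_subtractf algebra_simps)
  have "laplacian (dominated_edges S V E) f s =
      (\<Sum>v\<in>V. 1 / real k * (A - f v))"
    unfolding laplacian_def incident_edges_dominated_new[OF assms] sum.reindex[OF inj_new_edge] o_def
    by (intro sum.cong refl) (simp only: * card_new_edge, simp)
  also have "\<dots> = 1 / real k * (\<Sum>v\<in>V. A - f v)"
    by (simp only: sum_distrib_left)
  also have "\<dots> = (real (card V) * ((real k + 1) * f s - sum f S) - sum f V) / real k"
    by (simp add: sum_subtractf A_def)
  finally show ?thesis .
qed

lemma hypergraph_dominated: "hypergraph (V \<union> S) (dominated_edges S V E)"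
  using hyp S k card_new_edge by (auto simp: hypergraph_def dominated_edges_def)

text \<open>Extended by zero, a zero-sum function \<open>f\<close> on \<open>V\<close> meets \<open>k\<close> zeros in the new edge at an old
  vertex \<open>v\<close>, which contributes \<open>f v\<close>: the eigenvalue grows by \<open>1\<close>.  At a vertex of \<open>S\<close> the
  contributions of the new edges cancel.  The differences of two indicators
  of points of \<open>S\<close> and the function that is constant on \<open>V\<close> and on \<open>S\<close> supply the remaining
  \<open>k\<close> eigenvectors.\<close>

lemma eigenvectors_in_dominated:
  assumes ev: "eigenvectors_in (zero_sum_functions_on V) (laplacian E) M"
  shows "eigenvectors_in (zero_sum_functions_on (V \<union> S)) (laplacian (dominated_edges S V E))
    (image_mset (\<lambda>x. x + 1) M + replicate_mset (k - 1) ((real k + 1) / real k * real (card V))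
       + {#real (card V) / real k + 1#})"
proof -
  let ?L = "laplacian (dominated_edges S V E)"
  define \<mu> where "\<mu> = (real k + 1) / real k * real (card V)"
  define W :: "'a set \<Rightarrow> ('a \<Rightarrow> real) set"
    where "W T = {f \<in> functions_on (V \<union> T). sum f V = 0 \<and> sum f T = 0}" for T
  have fin: "finite V" and ne: "card V > 0" using hyp by (auto simp: hypergraph_def card_gt_0_iff)
  have kpos: "real k > 0" using k by simp
  have subspace: "fun_vs.subspace (W T)" for T
    by (auto simp: W_def fun_vs.subspace_def functions_on_def sum.distrib simp flip: sum_distrib_left)
  have vanish: "?L f v = \<mu> * f v" if "\<And>u. u \<notin> S \<Longrightarrow> f u = 0" "sum f S = 0" for f v
  proof -
    have "laplacian E f v = 0"
      using that(1) S(3) by (intro laplacian_const[OF hyp, where c = 0]) blast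
    have "sum f V = 0" using that(1) S(3) by (intro sum.neutral) blast
    consider "v \<in> V" "v \<notin> S" | "v \<in> S" | "v \<notin> V \<union> S" by blast
    then show ?thesis
    proof cases
      case 1
      then show ?thesis using that \<open>laplacian E f v = 0\<close>
        by (simp add: laplacian_dominated_old)
    next
      case 2
      then show ?thesis using that(2) \<open>sum f V = 0\<close>
        by (simp add: laplacian_dominated_new \<mu>_def)
    next
      case 3
      then show ?thesis using that(1)[of v]
        by (simp add: laplacian_outside[OF hypergraph_dominated])
    qed
  qed
  \<comment> \<open>The differences are added one by one: each new one is nonzero at a point where all
    earlier functions vanish.\<close>
  have "eigenvectors_in (W T) ?L (image_mset (\<lambda>x. x + 1) M + replicate_mset (card T - 1) \<mu>)"
    if "finite T" "T \<noteq> {}" "T \<subseteq> S" for T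
    using that
  proof (induction rule: finite_ne_induct)
    case (singleton s)
    have "zero_sum_functions_on V \<subseteq> W {s}"
      using singleton S by (auto simp: zero_sum_functions_on_def W_def functions_on_def)
    moreover have "?L f v = laplacian E f v + 1 * f v" if f: "f \<in> zero_sum_functions_on V" for f v
    proof -
      have f0: "f v = 0" if "v \<notin> V" for v using that f
        by (auto simp: zero_sum_functions_on_def functions_on_def)
      have "sum f V = 0" using f by (auto simp: zero_sum_functions_on_def)
      have "sum f S = 0" using f0 S(3) by (intro sum.neutral) blast
      consider "v \<in> V" | "v \<in> S" "v \<notin> V" | "v \<notin> V \<union> S" by blast
      then show ?thesis
      proof cases
        case 1
        then show ?thesis using \<open>sum f S = 0\<close> kpos by (simp add: laplacian_dominated_old)
      next
        case 2
        then show ?thesis using \<open>sum f S = 0\<close> \<open>sum f V = 0\<close> f0[of v]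
          by (simp add: laplacian_dominated_new laplacian_outside[OF hyp])
      next
        case 3
        then show ?thesis using f0[of v]
          by (simp add: laplacian_outside[OF hypergraph_dominated] laplacian_outside[OF hyp])
      qed
    qed
    ultimately show ?case using eigenvectors_in_change[OF ev, of "W {s}" ?L 1] by simp
  next
    case (insert t T)
    obtain s where s: "s \<in> T" using insert by auto
    define f where "f u = (if u = t then 1 else if u = s then -1 else (0::real))" for u
    have "t \<noteq> s" "s \<in> S" "t \<in> S" "t \<notin> V" "s \<notin> V" using s insert S by auto
    have f_eq: "f = (\<lambda>u. (if u = t then 1 else 0) - (if u = s then 1 else 0))"
      using \<open>t \<noteq> s\<close> by (auto simp: f_def fun_eq_iff)
    have sums: "sum f S = 0" "sum f V = 0" "sum f (insert t T) = 0"
      using \<open>s \<in> S\<close> \<open>t \<in> S\<close> \<open>t \<notin> V\<close> \<open>s \<notin> V\<close> s S fin insert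
      unfolding f_eq sum_subtractf by (simp_all add: sum.delta)
    have "eigenvectors_in (W (insert t T)) ?L
        (add_mset \<mu> (image_mset (\<lambda>x. x + 1) M + replicate_mset (card T - 1) \<mu>))"
    proof (rule eigenvectors_in_add)
      show "eigenvectors_in (W T) ?L (image_mset (\<lambda>x. x + 1) M + replicate_mset (card T - 1) \<mu>)"
        using insert by simp
      show "W T \<subseteq> W (insert t T)"
        using insert \<open>t \<notin> V\<close> by (auto simp: W_def functions_on_def)
      show "f \<in> W (insert t T)"
        using sums s by (auto simp: W_def functions_on_def f_def)
      show "f \<notin> W T" using insert \<open>t \<notin> V\<close> by (auto simp: W_def functions_on_def f_def)
      show "?L f v = \<mu> * f v" for v
        using sums \<open>s \<in> S\<close> \<open>t \<in> S\<close> by (intro vanish) (auto simp: f_def)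
    qed (rule subspace)
    moreover have "card (insert t T) - 1 = Suc (card T - 1)"
      using insert by (simp add: card_gt_0_iff)
    ultimately show ?case by simp
  qed
  from this[OF S(1) dominating_set_nonempty subset_refl]
  have S_ev: "eigenvectors_in (W S) ?L (image_mset (\<lambda>x. x + 1) M + replicate_mset (k - 1) \<mu>)"
    using S by simp
  \<comment> \<open>The weights make the total sum vanish, while the sum over \<open>V\<close> alone does not;
    the latter separates this function from all previous ones.\<close>
  define g where "g u = (if u \<in> V then real k else if u \<in> S then - real (card V) else 0)" for u
  have gS: "g u = - real (card V)" if "u \<in> S" for u using that S by (auto simp: g_def)
  have sums: "sum g V = real (card V) * real k" "sum g S = - (real k * real (card V))"
    using S gS by (auto simp: g_def)
  have "eigenvectors_in (zero_sum_functions_on (V \<union> S)) ?L (add_mset (real (card V) / real k + 1)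
       (image_mset (\<lambda>x. x + 1) M + replicate_mset (k - 1) \<mu>))"
  proof (rule eigenvectors_in_add[OF S_ev subspace])
    show "W S \<subseteq> zero_sum_functions_on (V \<union> S)"
      using S fin by (auto simp: W_def zero_sum_functions_on_def sum.union_disjoint Int_commute)
    show "g \<in> zero_sum_functions_on (V \<union> S)"
      using S fin sums
      by (simp add: zero_sum_functions_on_def sum.union_disjoint Int_commute functions_on_def)
        (auto simp: g_def)
    show "g \<notin> W S" using sums ne kpos by (auto simp: W_def)
    show "?L g v = (real (card V) / real k + 1) * g v" for v
    proof -
      have "laplacian E g v = 0" by (rule laplacian_const[OF hyp]) (simp add: g_def)
      consider "v \<in> V" | "v \<in> S" "v \<notin> V" | "v \<notin> V \<union> S" by blast
      then show ?thesis
      proof cases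
        case 1
        then show ?thesis using \<open>laplacian E g v = 0\<close> sums(2) kpos
          by (simp add: laplacian_dominated_old g_def field_simps)
      next
        case 2
        then show ?thesis using sums gS[of v] kpos
          by (simp add: laplacian_dominated_new field_simps)
      next
        case 3
        then show ?thesis by (simp add: laplacian_outside[OF hypergraph_dominated] g_def)
      qed
    qed
  qed
  then show ?thesis by (simp add: \<mu>_def)
qed

end

lemma eigenvectors_in_isolated:
  assumes hyp: "hypergraph V E" and v: "v \<notin> V"
    and ev: "eigenvectors_in (zero_sum_functions_on V) (laplacian E) M"
  shows "eigenvectors_in (zero_sum_functions_on (insert v V)) (laplacian E) (add_mset 0 M)"
proof (rule eigenvectors_in_add[OF ev subspace_zero_sum_functions_on])
  have fin: "finite V" using hyp by (auto simp: hypergraph_def)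
  define f where "f u = (if u = v then real (card V) else if u \<in> V then -1 else 0)" for u
  have "(\<Sum>u\<in>V. f u) = (\<Sum>u\<in>V. -1)" using v by (intro sum.cong) (auto simp: f_def)
  then have "sum f V = - real (card V)" by simp
  then show "f \<in> zero_sum_functions_on (insert v V)"
    using fin v by (auto simp: zero_sum_functions_on_def functions_on_def f_def)
  show "f \<notin> zero_sum_functions_on V" using v fin hyp
    by (auto simp: zero_sum_functions_on_def functions_on_def f_def hypergraph_def)
  show "laplacian E f u = 0 * f u" for u
    using v by (subst laplacian_const[OF hyp, of f "-1"]) (auto simp: f_def)
  show "zero_sum_functions_on V \<subseteq> zero_sum_functions_on (insert v V)"
    using fin v by (auto simp: zero_sum_functions_on_def functions_on_def)
qed

section \<open>Sums of multisets\<close>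

lemma image_mset_sum: "image_mset f (\<Sum>i\<in>I. M i) = (\<Sum>i\<in>I. image_mset f (M i))"
  by (induction I rule: infinite_finite_induct) auto

lemma set_mset_sum:
  "finite I \<Longrightarrow> set_mset (\<Sum>i\<in>I. M i) = (\<Union>i\<in>I. set_mset (M i))"
  by (induction I rule: finite_induct) auto

lemma filter_mset_sum: "filter_mset P (\<Sum>i\<in>I. M i) = (\<Sum>i\<in>I. filter_mset P (M i))"
  by (induction I rule: infinite_finite_induct) auto

lemma filter_replicate_mset: "filter_mset P (replicate_mset m x) = (if P x then replicate_mset m x else {#})"
  by (induction m) auto

lemma size_sum: "size (\<Sum>i\<in>I. M i :: 'b multiset) = (\<Sum>i\<in>I. size (M i))"
  by (induction I rule: infinite_finite_induct) auto

lemma sum_singleton_mset: "(\<Sum>j\<in>A. {#x#}) = replicate_mset (card A) x"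
  by (induction A rule: infinite_finite_induct) auto

section \<open>Degrees and spectrum from the construction sequence\<close>

text \<open>The construction is read backwards from its end.  There are \<open>r\<close> dominations, \<open>n 0\<close> is the
  final number of vertices, and for \<open>1 \<le> i \<le> r\<close> the number of vertices present just before the
  \<open>i\<close>-th domination from the end is \<open>n i\<close>.  Backward indexing makes the data stable: a further
  domination shifts the sequence, and an isolated vertex changes only \<open>n 0\<close>.\<close>

definition profile :: "nat \<Rightarrow> nat \<Rightarrow> (nat \<Rightarrow> nat) \<Rightarrow> bool" where
  "profile k r n \<longleftrightarrow> n r \<ge> 1 \<and> (\<forall>i<r. n (Suc i) + k \<le> n i)"

text \<open>The three summands are the isolated vertices that are followed by exactly \<open>i < r\<close> dominations,
  the vertices older than every domination, and the dominating sets.\<close>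

definition degree_mset :: "nat \<Rightarrow> nat \<Rightarrow> (nat \<Rightarrow> nat) \<Rightarrow> nat multiset" where
  "degree_mset k r n =
     (\<Sum>i<r. replicate_mset (n i - n (Suc i) - k) i) + replicate_mset (n r) r
     + (\<Sum>i<r. replicate_mset k (n (Suc i) + i))"

text \<open>The spectrum on the zero-sum functions, that is, with one eigenvalue \<open>0\<close> (of the constant
  functions) taken out.  This part is what behaves well under domination.\<close>

definition zero_sum_spectrum :: "nat \<Rightarrow> nat \<Rightarrow> (nat \<Rightarrow> nat) \<Rightarrow> real multiset" where
  "zero_sum_spectrum k r n =
     (\<Sum>i<r. replicate_mset (n i - n (Suc i) - k) (real i)) + replicate_mset (n r - 1) (real r)
     + (\<Sum>i<r. {#real (n (Suc i)) / real k + real (Suc i)#})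
     + (\<Sum>i<r. replicate_mset (k - 1) ((real k + 1) / real k * real (n (Suc i)) + real i))"

lemma profile_isolated: "profile k r n \<Longrightarrow> profile k r (n(0 := Suc (n 0)))"
  by (auto simp: profile_def)

lemma profile_dominated:
  "profile k r n \<Longrightarrow> profile k (Suc r) (case_nat (n 0 + k) n)"
  by (auto simp: profile_def split: nat.split)

lemma degree_mset_isolated:
  assumes "profile k r n"
  shows "degree_mset k r (n(0 := Suc (n 0))) = add_mset 0 (degree_mset k r n)"
proof (cases r)
  case (Suc r')
  then have "Suc (n 0) - n (Suc 0) - k = Suc (n 0 - n (Suc 0) - k)"
    using assms by (auto simp: profile_def)
  then show ?thesis unfolding Suc degree_mset_def sum.lessThan_Suc_shift by simp
qed (simp add: degree_mset_def)

lemma zero_sum_spectrum_isolated: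
  assumes "profile k r n"
  shows "zero_sum_spectrum k r (n(0 := Suc (n 0))) = add_mset 0 (zero_sum_spectrum k r n)"
proof (cases r)
  case 0
  then have "n 0 = Suc (n 0 - 1)" using assms by (simp add: profile_def)
  \<comment> \<open>Without dominations the number of zeros is the truncated difference \<open>n 0 - 1\<close>, which grows because \<open>n 0\<close> is positive.\<close>
  then show ?thesis unfolding 0 zero_sum_spectrum_def by (cases "n 0") auto
next
  case (Suc r')
  then have "Suc (n 0) - n (Suc 0) - k = Suc (n 0 - n (Suc 0) - k)"
    using assms by (auto simp: profile_def)
  then show ?thesis unfolding Suc zero_sum_spectrum_def sum.lessThan_Suc_shift by simp
qed

lemma degree_mset_dominated:
  "degree_mset k (Suc r) (case_nat (n 0 + k) n) =
     image_mset Suc (degree_mset k r n) + replicate_mset k (n 0)"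
  unfolding degree_mset_def sum.lessThan_Suc_shift by (simp add: image_mset_sum)

lemma zero_sum_spectrum_dominated:
  "zero_sum_spectrum k (Suc r) (case_nat (n 0 + k) n) =
     image_mset (\<lambda>x. x + 1) (zero_sum_spectrum k r n)
     + replicate_mset (k - 1) ((real k + 1) / real k * real (n 0)) + {#real (n 0) / real k + 1#}"
  unfolding zero_sum_spectrum_def sum.lessThan_Suc_shift
  by (simp add: image_mset_sum add_ac)

definition has_profile :: "nat \<Rightarrow> 'a set \<Rightarrow> 'a set set \<Rightarrow> nat \<Rightarrow> (nat \<Rightarrow> nat) \<Rightarrow> bool" where
  "has_profile k V E r n \<longleftrightarrow> profile k r n \<and> n 0 = card V \<and>
     image_mset (degree E) (mset_set V) = degree_mset k r n \<and>
     eigenvectors_in (zero_sum_functions_on V) (laplacian E) (zero_sum_spectrum k r n)"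

lemma has_profile_dominated:
  assumes "hypergraph V E" "finite S" "card S = k" "S \<inter> V = {}" "k \<ge> 1" "has_profile k V E r n"
  shows "has_profile k (V \<union> S) (dominated_edges S V E) (Suc r) (case_nat (n 0 + k) n)"
proof -
  have fin: "finite V" using assms(1) by (auto simp: hypergraph_def)
  have n0: "card V = n 0" using assms by (simp add: has_profile_def)
  have "image_mset (degree (dominated_edges S V E)) (mset_set V) = image_mset (\<lambda>v. Suc (degree E v)) (mset_set V)"
    using fin by (intro image_mset_cong) (simp add: degree_dominated_old[OF assms(1-5)])
  also have "\<dots> = image_mset Suc (degree_mset k r n)"
    using assms(6) by (simp add: has_profile_def flip: image_mset.compositionality[unfolded o_def])
  finally have old: "image_mset (degree (dominated_edges S V E)) (mset_set V) = \<dots>" .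
  have "image_mset (degree (dominated_edges S V E)) (mset_set S) = image_mset (\<lambda>v. card V) (mset_set S)"
    using assms(2) by (intro image_mset_cong) (simp add: degree_dominated_new[OF assms(1-5)])
  also have "\<dots> = replicate_mset k (card V)"
    using assms(2,3) by (simp add: image_mset_const_eq)
  finally have "image_mset (degree (dominated_edges S V E)) (mset_set (V \<union> S)) =
      degree_mset k (Suc r) (case_nat (n 0 + k) n)"
    using old fin assms(2,4) by (simp add: mset_set_Union Int_commute degree_mset_dominated n0)
  moreover have "card (V \<union> S) = n 0 + k"
    using fin assms(2-4) n0 by (simp add: card_Un_disjoint Int_commute)
  ultimately show ?thesis
    using assms(6) eigenvectors_in_dominated[OF assms(1-5), of "zero_sum_spectrum k r n"]
    unfolding has_profile_def zero_sum_spectrum_dominated n0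
    by (simp add: profile_dominated)
qed

lemma threshold_hypergraph_has_profile:
  assumes "threshold_hypergraph k V E" "k \<ge> 1"
  shows "\<exists>r n. has_profile k V E r n"
  using assms(1)
proof induction
  case (single v)
  have "has_profile k {v} {} 0 (\<lambda>_. 1)"
    by (simp add: has_profile_def profile_def degree_mset_def zero_sum_spectrum_def
        degree_def incident_edges_def eigenvectors_in_empty)
  then show ?case by blast
next
  case (isolated V E v)
  then obtain r n where rn: "has_profile k V E r n" by blast
  have hyp: "hypergraph V E"
    using isolated(1) by (rule threshold_hypergraph_is_hypergraph[OF assms(2)])
  then have fin: "finite V" by (auto simp: hypergraph_def)
  have "incident_edges E v = {}"
    using hyp isolated(2) by (auto simp: incident_edges_def hypergraph_def)
  then have "degree E v = 0" by (simp add: degree_def)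
  moreover have "profile k r n" "card V = n 0"
      "image_mset (degree E) (mset_set V) = degree_mset k r n"
      "eigenvectors_in (zero_sum_functions_on V) (laplacian E) (zero_sum_spectrum k r n)"
    using rn by (auto simp: has_profile_def)
  ultimately have "has_profile k (insert v V) E r (n(0 := Suc (n 0)))"
    using fin isolated(2) eigenvectors_in_isolated[OF hyp isolated(2)]
    by (simp add: has_profile_def profile_isolated degree_mset_isolated zero_sum_spectrum_isolated)
  then show ?case by blast
next
  case (domination V E S)
  then obtain r n where "has_profile k V E r n" by blast
  moreover have "hypergraph V E"
    using domination(1) by (rule threshold_hypergraph_is_hypergraph[OF assms(2)])
  ultimately show ?case
    using has_profile_dominated[of V E S k] domination assms(2) by blast
qed

lemma connected_has_profile:
  assumes "connected_threshold_hypergraph k V E" "k \<ge> 1"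
  obtains r n where "r \<ge> 1" "has_profile k V E r n" "n 0 = n 1 + k"
proof -
  obtain V' E' S where *: "threshold_hypergraph k V' E'" "finite S" "card S = k" "S \<inter> V' = {}"
      "V = V' \<union> S" "E = dominated_edges S V' E'"
    using assms(1) unfolding connected_threshold_hypergraph_def by blast
  obtain r n where "has_profile k V' E' r n"
    using threshold_hypergraph_has_profile[OF *(1) assms(2)] by blast
  from has_profile_dominated[OF threshold_hypergraph_is_hypergraph[OF assms(2) *(1)] *(2-4) assms(2) this]
  show thesis using *(5,6) that[of "Suc r" "case_nat (n 0 + k) n"] by simp
qed

lemma size_zero_sum_spectrum:
  assumes "k \<ge> 1"
  shows "profile k r n \<Longrightarrow> Suc (size (zero_sum_spectrum k r n)) = n 0"
proof (induction r arbitrary: n)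
  case 0
  then show ?case by (simp add: zero_sum_spectrum_def profile_def)
next
  case (Suc r)
  then have "profile k r (\<lambda>i. n (Suc i))" and le: "n (Suc 0) + k \<le> n 0"
    by (auto simp: profile_def)
  then have "Suc (size (zero_sum_spectrum k r (\<lambda>i. n (Suc i)))) = n (Suc 0)"
    by (intro Suc.IH)
  then show ?case using le assms
    unfolding zero_sum_spectrum_def sum.lessThan_Suc_shift by (simp add: size_sum)
qed

text \<open>The constant function on \<open>V\<close> completes the zero-sum eigenvectors to a basis.\<close>

lemma complete_eigenvalue_list_zero_sum:
  assumes "hypergraph V E" "eigenvectors_in (zero_sum_functions_on V) (laplacian E) M"
    and "Suc (size M) = card V"
  shows "complete_eigenvalue_list V (laplacian E) (add_mset 0 M)"
proof (rule complete_eigenvalue_listI)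
  have V: "finite V" "V \<noteq> {}" using assms(1) by (auto simp: hypergraph_def)
  show "finite V" by fact
  define f :: "'a \<Rightarrow> real" where "f = (\<lambda>u. if u \<in> V then 1 else 0)"
  show "eigenvectors_in (functions_on V) (laplacian E) (add_mset 0 M)"
  proof (rule eigenvectors_in_add[OF assms(2) subspace_zero_sum_functions_on, of _ f])
    show "f \<notin> zero_sum_functions_on V"
      using V by (auto simp: zero_sum_functions_on_def f_def)
    show "laplacian E f u = 0 * f u" for u
      by (subst laplacian_const[OF assms(1), of f 1]) (auto simp: f_def)
  qed (auto simp: zero_sum_functions_on_def functions_on_def f_def)
qed (use assms in \<open>auto simp: laplacian_outside laplacian_sum\<close>)

section \<open>Column sums and the eigenvalue list\<close>

lemma size_degree_mset: "profile k r n \<Longrightarrow> size (degree_mset k r n) = n 0"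
proof (induction r arbitrary: n)
  case (Suc r)
  then have "profile k r (\<lambda>i. n (Suc i))" and le: "n (Suc 0) + k \<le> n 0"
    by (auto simp: profile_def)
  then have "size (degree_mset k r (\<lambda>i. n (Suc i))) = n (Suc 0)" by (intro Suc.IH)
  then show ?case using le
    unfolding degree_mset_def sum.lessThan_Suc_shift by (simp add: size_sum)
qed (simp add: degree_mset_def)

text \<open>Forgetting the last domination and all that follows it leaves the data \<open>\<lambda>i. n (Suc i)\<close>, which makes
  induction on the number of dominations possible.\<close>

lemma degree_mset_Suc:
  "degree_mset k (Suc r) n = replicate_mset (n 0 - n (Suc 0) - k) 0
     + image_mset Suc (degree_mset k r (\<lambda>i. n (Suc i))) + replicate_mset k (n (Suc 0))"
  unfolding degree_mset_def sum.lessThan_Suc_shift by (simp add: image_mset_sum)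

text \<open>\<open>n (Suc j) + j\<close> is the degree of the dominating vertices added in the domination with number
  \<open>j + 1\<close> from the end: the degree of a later
  dominating vertex is at least as large.\<close>

lemma profile_antimono:
  assumes "profile k r n" "k \<ge> 1" "i \<le> j" "j < r"
  shows "n (Suc j) + j \<le> n (Suc i) + i"
  using assms(3,4)
proof (induction rule: dec_induct)
  case (step m)
  then show ?case using assms(1,2) by (force simp: profile_def)
qed simp

lemma profile_ge:
  assumes "profile k r n" "k \<ge> 1" "j < r"
  shows "r \<le> n (Suc j) + j" and "n r \<ge> 2 \<Longrightarrow> r < n (Suc j) + j"
proof -
  have "n r + (r - 1) \<le> n (Suc j) + j"
    using profile_antimono[OF assms(1,2), of j "r - 1"] assms(3) by simp
  moreover have "n r \<ge> 1" using assms(1) by (simp add: profile_def)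
  ultimately show "r \<le> n (Suc j) + j" and "n r \<ge> 2 \<Longrightarrow> r < n (Suc j) + j" using assms(3) by auto
qed

text \<open>The vertices of degree at least \<open>i\<close> are those present before the \<open>i\<close>-th domination from the
  end, together with the dominating sets added from there on.\<close>

lemma column_count_le:
  assumes "profile k r n" "k \<ge> 1" "1 \<le> i" "i \<le> r"
  shows "size {#x \<in># degree_mset k r n. i \<le> x#} = n i + k * i"
  using assms(1,3,4)
proof (induction r arbitrary: n i)
  case (Suc r)
  have p: "profile k r (\<lambda>i. n (Suc i))" using Suc.prems(1) by (auto simp: profile_def)
  have "i \<le> n (Suc 0)" using profile_ge(1)[OF Suc.prems(1) assms(2), of 0] Suc.prems by simp
  moreover obtain i' where i': "i = Suc i'" using Suc.prems by (cases i) auto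
  moreover have "size {#x \<in># degree_mset k r (\<lambda>i. n (Suc i)). i' \<le> x#} = n i + k * i'"
  proof (cases "i' = 0")
    case True
    then show ?thesis using size_degree_mset[OF p] i' by simp
  next
    case False
    then show ?thesis using Suc.IH[OF p, of i'] Suc.prems i' by simp
  qed
  ultimately show ?case
    unfolding degree_mset_Suc by (simp add: filter_replicate_mset filter_mset_image_mset)
qed simp

text \<open>At the threshold \<open>n i + i - 1\<close>, which exceeds the degree of every vertex outside the dominating
  sets, exactly the \<open>i\<close> last dominating sets are counted.  The strict inequality to the next set is
  what makes the count exact.\<close>

lemma column_count_block:
  assumes "profile k r n" "k \<ge> 1" "1 \<le> i" "i \<le> r"
    and "r < n i + i - 1" "i < r \<Longrightarrow> n (Suc i) + i < n i + i - 1"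
  shows "size {#x \<in># degree_mset k r n. n i + i - 1 \<le> x#} = k * i"
proof -
  have *: "n i + i - 1 \<le> n (Suc j) + j \<longleftrightarrow> j < i" if "j < r" for j
  proof
    assume le: "n i + i - 1 \<le> n (Suc j) + j"
    show "j < i"
    proof (rule ccontr)
      assume "\<not> j < i"
      then have "n (Suc j) + j \<le> n (Suc i) + i" "i < r"
        using profile_antimono[OF assms(1,2), of i j] that by auto
      then show False using le assms(6) by simp
    qed
  next
    assume "j < i"
    then show "n i + i - 1 \<le> n (Suc j) + j"
      using profile_antimono[OF assms(1,2), of j "i - 1"] assms(3,4) by simp
  qed
  have "size {#x \<in># degree_mset k r n. n i + i - 1 \<le> x#} = (\<Sum>j<r. if j < i then k else 0)"
    using assms(5) * by (simp add: degree_mset_def filter_mset_sum filter_replicate_mset size_sum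
        if_distrib[of size] cong: sum.cong_simp if_cong)
  also have "\<dots> = (\<Sum>j<i. k)"
    using assms(4) by (intro sum.mono_neutral_cong_right) auto
  finally show ?thesis by simp
qed

lemma durfee_eqI:
  assumes "D (Suc d) \<le> d" "\<And>s. 1 \<le> s \<Longrightarrow> s \<le> d \<Longrightarrow> s \<le> D s"
  shows "durfee D = d"
proof -
  have "(LEAST s. s \<ge> 1 \<and> D s < s) = Suc d"
  proof (rule Least_equality)
    fix y assume "1 \<le> y \<and> D y < y"
    then show "Suc d \<le> y" using assms(2)[of y] by (cases "y \<le> d") auto
  qed (use assms in auto)
  then show ?thesis by (simp add: durfee_def)
qed

lemma profile_pos: "profile k r n \<Longrightarrow> k \<ge> 1 \<Longrightarrow> i \<le> r \<Longrightarrow> n i \<ge> 1"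
  by (cases "i = r") (auto simp: profile_def Suc_le_eq dest: spec[of _ i])

lemma durfee_profile:
  assumes "profile k r n" "k \<ge> 1"
    and D: "\<And>i. 1 \<le> i \<Longrightarrow> i \<le> r \<Longrightarrow> D i = n i + i - 1" "D (Suc r) \<le> r"
  shows "durfee D = r"
  using D(2)
proof (rule durfee_eqI)
  fix s assume "1 \<le> s" "s \<le> r"
  then show "s \<le> D s" using D(1)[of s] profile_pos[OF assms(1,2), of s] by simp
qed

text \<open>By the two counts above, \<open>C (D i) = k i\<close> wherever its multiplicity is positive, and
  \<open>C i = n i + k i\<close>; the items of the list match the summands of the spectrum one by one.  The hypothesis on \<open>D\<close> describes both
  the blocks for \<open>k \<ge> 2\<close> and the rows for \<open>k = 1\<close>: beyond the dominating sets only the value at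
  \<open>r + 1\<close> matters, and it is \<open>r\<close> if several vertices are older than every domination, at most
  \<open>r\<close> otherwise.\<close>

lemma ferrers_eigenvalues_profile:
  assumes p: "profile k r n" and k: "k \<ge> 1" and r: "r \<ge> 1" "n 0 = n 1 + k"
    and D: "\<And>i. 1 \<le> i \<Longrightarrow> i \<le> r \<Longrightarrow> D i = n i + i - 1" "D (Suc r) \<le> r"
      "n r \<ge> 2 \<Longrightarrow> D (Suc r) = r"
    and C: "\<And>i. C i = size {#x \<in># degree_mset k r n. i \<le> x#}"
  shows "ferrers_eigenvalues k C D = add_mset 0 (zero_sum_spectrum k r n)"
proof -
  have d: "durfee D = r" by (rule durfee_profile[OF p k D(1,2)])
  have kpos: "real k > 0" using k by simp
  have pos: "n i \<ge> 1" if "i \<le> r" for i using profile_pos[OF p k that] .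
  have step: "n (Suc i) + k \<le> n i" if "i < r" for i using p that by (simp add: profile_def)
  have "(\<Sum>i\<in>{1..<r}. replicate_mset (nat (int (D i) - int (D (i + 1)) - int k + 1))
      (1 / real k * real (C (D i)))) = (\<Sum>i\<in>{1..<r}. replicate_mset (n i - n (Suc i) - k) (real i))"
  proof (intro sum.cong refl)
    fix i assume "i \<in> {1..<r}"
    then have i: "1 \<le> i" "i < r" by auto
    have m: "nat (int (D i) - int (D (i + 1)) - int k + 1) = n i - n (Suc i) - k"
      using i D(1)[of i] D(1)[of "Suc i"] pos[of i] step[of i] by simp
    have "C (D i) = k * i" if "n i - n (Suc i) - k > 0"
    proof -
      have "n (Suc i) + i < n i + i - 1" using that k by simp
      moreover have "r \<le> n (Suc i) + i" using profile_ge(1)[OF p k i(2)] .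
      ultimately show ?thesis
        using column_count_block[OF p k i(1)] i D(1)[of i] C by simp
    qed
    then show "replicate_mset (nat (int (D i) - int (D (i + 1)) - int k + 1))
      (1 / real k * real (C (D i))) = replicate_mset (n i - n (Suc i) - k) (real i)"
      unfolding m using kpos by (cases "n i - n (Suc i) - k > 0") auto
  qed
  \<comment> \<open>By \<open>n 0 = n 1 + k\<close> no isolated vertex follows the last domination, so the term for \<open>i = 0\<close> is empty.\<close>
  also have "\<dots> = (\<Sum>i<r. replicate_mset (n i - n (Suc i) - k) (real i))"
  proof (rule sum.mono_neutral_left)
    show "\<forall>i\<in>{..<r} - {1..<r}. replicate_mset (n i - n (Suc i) - k) (real i) = 0"
      using r by (auto simp: Suc_le_eq)
  qed auto
  finally have ii: "(\<Sum>i\<in>{1..<r}. replicate_mset (nat (int (D i) - int (D (i + 1)) - int k + 1))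
      (1 / real k * real (C (D i)))) = \<dots>" .
  have iii: "(if D r \<noteq> r then replicate_mset (D r - D (r + 1)) (1 / real k * real (C (D r))) else {#}) =
      replicate_mset (n r - 1) (real r)"
  proof (cases "n r \<ge> 2")
    case True
    then have "C (D r) = k * r"
      using column_count_block[OF p k r(1)] D(1)[of r] r C by simp
    then show ?thesis using D(1)[of r] D(3) True r kpos by simp
  next
    case False
    then have "n r = 1" using pos[of r] by simp
    then show ?thesis using D(1)[of r] r by simp
  qed
  have "(\<Sum>i\<in>{1..r}. replicate_mset 1 (1 / real k * real (C i))) =
      (\<Sum>i<r. {#real (n (Suc i)) / real k + real (Suc i)#})"
    unfolding One_nat_def sum.atLeast1_atMost_eq
    using kpos by (intro sum.cong refl) (simp add: C column_count_le[OF p k] field_simps)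
  moreover have "(\<Sum>i\<in>{1..r}. replicate_mset (k - 1)
                         (1 / real k * ((real k + 1) * real (D i) - real i + 1))) =
      (\<Sum>i<r. replicate_mset (k - 1) ((real k + 1) / real k * real (n (Suc i)) + real i))"
    unfolding One_nat_def sum.atLeast1_atMost_eq
    using kpos by (intro sum.cong refl) (simp add: D(1) field_simps)
  ultimately show ?thesis
    unfolding ferrers_eigenvalues_def Let_def d ii iii zero_sum_spectrum_def by simp
qed

section \<open>Blocks and rows\<close>

lemma rev_sorted_list_of_multiset_eqI:
  assumes "sorted_wrt (\<ge>) xs" "mset xs = M"
  shows "rev (sorted_list_of_multiset M) = (xs :: nat list)"
proof -
  have "sorted (rev xs)" using assms(1) by (simp add: sorted_wrt_rev)
  then have "sorted_list_of_multiset (mset (rev xs)) = rev xs"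
    by (simp only: sorted_list_of_multiset_mset sorted_sort_id)
  then show ?thesis using assms(2) by simp
qed

lemma rev_sorted_list_of_set_eqI:
  assumes "sorted_wrt (>) xs" "set xs = A"
  shows "rev (sorted_list_of_set A) = (xs :: nat list)"
proof -
  have "sorted_wrt (<) (rev xs)" using assms(1) by (simp add: sorted_wrt_rev)
  then have "sorted_list_of_set (set (rev xs)) = rev xs"
    by (intro sorted_list_of_set.idem_if_sorted_distinct) (auto simp: strict_sorted_iff)
  then show ?thesis using assms(2) by simp
qed

lemma sorted_wrt_rev_sorted_list_of_set:
  "sorted_wrt (>) (rev (sorted_list_of_set (A :: nat set)))"
  using strict_sorted_list_of_set[of A] by (simp add: sorted_wrt_rev)

lemma sorted_wrt_rev_sorted_list_of_multiset:
  "sorted_wrt (\<ge>) (rev (sorted_list_of_multiset (M :: nat multiset)))"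
  using sorted_sorted_list_of_multiset[of M] by (simp add: sorted_wrt_rev)

lemma set_degree_mset:
  assumes "profile k r n" "k \<ge> 1"
  shows "set_mset (degree_mset k r n) =
    {i. i < r \<and> n (Suc i) + k < n i} \<union> {r} \<union> (\<lambda>i. n (Suc i) + i) ` {..<r}"
  using assms by (auto simp: degree_mset_def profile_def set_mset_sum split: if_splits)

text \<open>For \<open>k \<ge> 2\<close> different dominating sets have different degrees, so the \<open>i\<close>-th block comes from
  the \<open>i\<close>-th dominating set from the end.  If there is only one vertex older than every domination,
  it has the same degree \<open>r\<close> as the first dominating set and adds no block.\<close>

lemma block_width_profile:
  assumes p: "profile k r n" and k: "k \<ge> 2" and r: "r \<ge> 1" and ds: "set ds = set_mset (degree_mset k r n)"
  shows "1 \<le> i \<Longrightarrow> i \<le> r \<Longrightarrow> block_width ds i = n i + i - 1"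
    and "block_width ds (Suc r) \<le> r"
    and "n r \<ge> 2 \<Longrightarrow> block_width ds (Suc r) = r"
proof -
  have k1: "k \<ge> 1" using k by simp
  define Y where "Y = {i. i < r \<and> n (Suc i) + k < n i}"
  define ys where "ys = (if n r \<ge> 2 then [r] else []) @ rev (sorted_list_of_set Y)"
  define xs where "xs = map (\<lambda>i. n (Suc i) + i) [0..<r] @ ys"
  have finY: "finite Y" by (simp add: Y_def)
  have strict: "n (Suc j) + j < n (Suc i) + i" if "i < j" "j < r" for i j
  proof -
    have "n (Suc (Suc i)) + k \<le> n (Suc i)" using p that by (simp add: profile_def)
    then show ?thesis using profile_antimono[OF p k1, of "Suc i" j] that k by simp
  qed
  have ys_le: "\<forall>y\<in>set ys. y \<le> r" using finY by (auto simp: ys_def Y_def)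
  have "sorted_wrt (>) ys"
    using finY sorted_wrt_rev_sorted_list_of_set[of Y] by (auto simp: ys_def Y_def)
  moreover have "sorted_wrt (>) (map (\<lambda>i. n (Suc i) + i) [0..<r])"
    using strict by (auto simp: sorted_wrt_iff_nth_less)
  moreover have "y < n (Suc i) + i" if "i < r" "y \<in> set ys" for i y
    using profile_ge[OF p k1 that(1)] that(2) finY by (auto simp: ys_def Y_def split: if_splits)
  ultimately have "sorted_wrt (>) xs"
    by (auto simp: xs_def sorted_wrt_append)
  moreover have "set xs = set ds"
  proof -
    have "r \<in> (\<lambda>i. n (Suc i) + i) ` {..<r}" if "\<not> n r \<ge> 2"
    proof
      show "r = n (Suc (r - 1)) + (r - 1)" using that p r by (auto simp: profile_def)
    qed (use r in auto)
    then show ?thesis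
      unfolding ds set_degree_mset[OF p k1] xs_def ys_def using finY
      by (cases "n r \<ge> 2") (auto simp: Y_def)
  qed
  ultimately have eq: "rev (sorted_list_of_set (set ds)) = xs"
    by (rule rev_sorted_list_of_set_eqI)
  show "block_width ds i = n i + i - 1" if "1 \<le> i" "i \<le> r"
    using that by (auto simp: block_width_def row_length_def eq xs_def nth_append)
  have "block_width ds (Suc r) = row_length ys 1"
    by (auto simp: block_width_def row_length_def eq xs_def nth_append)
  moreover have "row_length ys 1 \<le> r"
    using ys_le by (cases ys) (auto simp: row_length_def)
  moreover have "row_length ys 1 = r" if "n r \<ge> 2"
    using that by (simp add: row_length_def ys_def)
  ultimately show "block_width ds (Suc r) \<le> r" "n r \<ge> 2 \<Longrightarrow> block_width ds (Suc r) = r"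
    by simp_all
qed

text \<open>A dominating set is a single vertex for \<open>k = 1\<close>, and the \<open>i\<close>-th row from above can be taken to
  belong to the dominating vertex of the \<open>i\<close>-th domination from the end, whether or not degrees
  repeat.\<close>

lemma row_length_profile:
  assumes p: "profile 1 r n" and ds: "ds = rev (sorted_list_of_multiset (degree_mset 1 r n))"
  shows "1 \<le> i \<Longrightarrow> i \<le> r \<Longrightarrow> row_length ds i = n i + i - 1"
    and "row_length ds (Suc r) = r"
proof -
  define Y where "Y = (\<Sum>i<r. replicate_mset (n i - n (Suc i) - 1) i)"
  define ys where "ys = replicate (n r) r @ rev (sorted_list_of_multiset Y)"
  define xs where "xs = map (\<lambda>i. n (Suc i) + i) [0..<r] @ ys"
  have Y_less: "y < r" if "y \<in># Y" for y
    using that by (auto simp: Y_def set_mset_sum split: if_splits)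
  have "sorted_wrt (\<ge>) ys"
    using sorted_wrt_rev_sorted_list_of_multiset[of Y] Y_less
    by (auto simp: ys_def sorted_wrt_append sorted_wrt_iff_nth_less[of _ "replicate _ _"] intro: less_imp_le)
  moreover have "sorted_wrt (\<ge>) (map (\<lambda>i. n (Suc i) + i) [0..<r])"
    using profile_antimono[OF p] by (auto simp: sorted_wrt_iff_nth_less)
  moreover have "y \<le> n (Suc i) + i" if "i < r" "y \<in> set ys" for i y
    using profile_ge(1)[OF p _ that(1)] that(2) Y_less[of y] by (auto simp: ys_def split: if_splits)
  ultimately have "sorted_wrt (\<ge>) xs"
    by (auto simp: xs_def sorted_wrt_append)
  moreover have "mset xs = degree_mset 1 r n"
  proof -
    have "mset (map f [0..<m]) = (\<Sum>i<m. {#f i#})" for m and f :: "nat \<Rightarrow> nat"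
      by (induction m) auto
    then show ?thesis by (simp add: xs_def ys_def Y_def degree_mset_def del: mset_map)
  qed
  ultimately have eq: "ds = xs"
    unfolding ds by (rule rev_sorted_list_of_multiset_eqI)
  show "row_length ds i = n i + i - 1" if "1 \<le> i" "i \<le> r"
    using that by (auto simp: row_length_def eq xs_def nth_append)
  have "row_length ds (Suc r) = row_length ys 1"
    by (auto simp: row_length_def eq xs_def nth_append)
  also have "\<dots> = r" using p by (auto simp: row_length_def ys_def nth_append profile_def)
  finally show "row_length ds (Suc r) = r" .
qed

lemma column_sum_conv: "column_sum ds i = size {#x \<in># mset ds. i \<le> x#}"
  by (simp add: column_sum_def length_filter_conv_card flip: mset_filter)

section \<open>Tight diagrams for \<open>k = 1\<close>\<close>

lemma row_length_antimono_step:
  assumes "sorted_wrt (\<ge>) xs" "i \<ge> 1"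
  shows "row_length xs (Suc i) \<le> row_length xs i"
  using assms by (auto simp: row_length_def sorted_wrt_iff_nth_less)

text \<open>No degree lies strictly between two consecutive rows or blocks, so the columns whose indices
  lie between their lengths have equal height.\<close>

lemma column_sum_const_between:
  assumes sorted: "sorted_wrt (\<ge>) xs" and set: "set xs = set ds" and "i \<ge> 1"
    and j: "row_length xs (Suc i) < j" "j \<le> row_length xs i"
  shows "column_sum ds j = column_sum ds (row_length xs i)"
proof -
  have "row_length xs i \<le> x" if "x \<in> set ds" "j \<le> x" for x
  proof (rule ccontr)
    assume less: "\<not> row_length xs i \<le> x"
    obtain m where m: "m < length xs" "x = xs ! m"
      using \<open>x \<in> set ds\<close> set by (metis in_set_conv_nth)
    have "i \<le> length xs" using j by (auto simp: row_length_def split: if_splits)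
    moreover have "\<not> m \<le> i - 1"
    proof
      assume "m \<le> i - 1"
      then have "xs ! (i - 1) \<le> xs ! m"
        using sorted \<open>i \<ge> 1\<close> \<open>i \<le> length xs\<close>
        by (cases "m = i - 1") (auto simp: sorted_wrt_iff_nth_less)
      then show False using less m \<open>i \<ge> 1\<close> \<open>i \<le> length xs\<close> by (simp add: row_length_def)
    qed
    ultimately have "x \<le> row_length xs (Suc i)"
      using sorted m by (cases "m = i") (auto simp: sorted_wrt_iff_nth_less row_length_def)
    then show False using j(1) that(2) by simp
  qed
  then have "{#x \<in># mset ds. j \<le> x#} = {#x \<in># mset ds. row_length xs i \<le> x#}"
    using j(2) by (intro filter_mset_cong) auto
  then show ?thesis by (simp add: column_sum_conv)
qed

lemma row_length_1_eq_Max: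
  assumes "sorted_wrt (\<ge>) xs" "set xs = set ds" "ds \<noteq> []"
  shows "row_length xs 1 = Max (set ds)"
proof -
  obtain y ys where xs: "xs = y # ys" using assms(2,3) by (cases xs) auto
  have "Max (set xs) = y" using assms(1) unfolding xs by (intro Max_eqI) auto
  then show ?thesis using assms(2) by (simp add: row_length_def xs)
qed

lemma durfee_bounds:
  assumes "D 1 \<ge> 1" "D s < s" "s \<ge> 1"
  shows "durfee D \<ge> 1" "durfee D \<le> D (durfee D)"
proof -
  define m where "m = (LEAST s. s \<ge> 1 \<and> D s < s)"
  have m: "m \<ge> 1 \<and> D m < m" unfolding m_def by (rule LeastI[of _ s]) (use assms in auto)
  moreover have "m \<noteq> 1" using m assms(1) by auto
  ultimately have "m \<ge> 2" by auto
  moreover have "durfee D = m - 1" by (simp add: durfee_def m_def)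
  moreover have "\<not> (m - 1 \<ge> 1 \<and> D (m - 1) < m - 1)"
    using not_less_Least[of "m - 1" "\<lambda>s. s \<ge> 1 \<and> D s < s"] \<open>m \<ge> 2\<close> by (simp add: m_def)
  ultimately show "durfee D \<ge> 1" "durfee D \<le> D (durfee D)" by auto
qed

text \<open>Grouping the columns beyond the \<open>D m\<close>-th by the row in which they end.\<close>

lemma sum_blocks:
  fixes D :: "nat \<Rightarrow> nat"
  assumes "m \<ge> 1" "\<And>i. i \<ge> 1 \<Longrightarrow> D (Suc i) \<le> D i"
    and g: "\<And>i j. i \<ge> 1 \<Longrightarrow> D (Suc i) < j \<Longrightarrow> j \<le> D i \<Longrightarrow> g j = g (D i)"
  shows "(\<Sum>i\<in>{1..<m}. replicate_mset (D i - D (Suc i)) (g (D i))) = (\<Sum>j\<in>{D m<..D 1}. {#g j#}) \<and> D m \<le> D 1"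
  using assms(1)
proof (induction m rule: dec_induct)
  case (step m)
  have "(\<Sum>j\<in>{D (Suc m)<..D m}. {#g j#}) = (\<Sum>j\<in>{D (Suc m)<..D m}. {#g (D m)#})"
  proof (intro sum.cong refl)
    fix j assume "j \<in> {D (Suc m)<..D m}"
    then show "{#g j#} = {#g (D m)#}" using g[of m j] step.hyps(1) by simp
  qed
  then have "(\<Sum>j\<in>{D (Suc m)<..D m}. {#g j#}) = replicate_mset (D m - D (Suc m)) (g (D m))"
    by (simp add: sum_singleton_mset)
  moreover have "D (Suc m) \<le> D m" using assms(2) step by simp
  moreover have "{D (Suc m)<..D 1} = {D (Suc m)<..D m} \<union> {D m<..D 1}"
    using step \<open>D (Suc m) \<le> D m\<close> by auto
  ultimately show ?case using step by (simp add: sum.union_disjoint add.commute)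
qed simp

text \<open>For \<open>k = 1\<close> the list consists of \<open>0\<close> and the column sums: the first \<open>d\<close> columns are listed
  singly, and the others up to column \<open>D 1\<close> are grouped by the row in which they end.
  Tightness says that the groups start exactly after column \<open>d\<close>, so that no column is
  counted twice.  The result depends only on the degree sequence; it is therefore the same for rows
  and for blocks.\<close>

lemma ferrers_eigenvalues_tight:
  assumes sorted: "sorted_wrt (\<ge>) xs" and set: "set xs = set ds"
    and pos: "\<exists>x\<in>set ds. x > 0" and tight: "durfee_tight (row_length xs)"
  shows "ferrers_eigenvalues 1 (column_sum ds) (row_length xs) =
    add_mset 0 (\<Sum>j\<in>{1..Max (set ds)}. {#real (column_sum ds j)#})"
proof -
  let ?D = "row_length xs"
  define d where "d = durfee ?D"
  define g where "g j = real (column_sum ds j)" for j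
  have ne: "ds \<noteq> []" using pos by auto
  have D1: "?D 1 = Max (set ds)" by (rule row_length_1_eq_Max[OF sorted set ne])
  obtain x where "x \<in> set ds" "x > 0" using pos by blast
  then have "x \<le> ?D 1" unfolding D1 by (intro Max_ge) auto
  then have "?D 1 \<ge> 1" using \<open>x > 0\<close> by linarith
  moreover have "?D (Suc (length xs)) < Suc (length xs)" by (simp add: row_length_def)
  ultimately have d: "d \<ge> 1" "d \<le> ?D d" using durfee_bounds[of ?D] unfolding d_def by auto
  have anti: "?D (Suc i) \<le> ?D i" if "i \<ge> 1" for i by (rule row_length_antimono_step[OF sorted that])
  have gconst: "g j = g (?D i)" if "i \<ge> 1" "?D (Suc i) < j" "j \<le> ?D i" for i j
    unfolding g_def using column_sum_const_between[OF sorted set that] by simp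
  have "(\<Sum>i\<in>{1..<d}. replicate_mset (?D i - ?D (Suc i)) (g (?D i)))
      + (if ?D d \<noteq> d then replicate_mset (?D d - ?D (d + 1)) (g (?D d)) else {#})
      = (\<Sum>j\<in>{d<..?D 1}. {#g j#}) \<and> d \<le> ?D 1"
  proof (cases "?D d = d")
    case True
    then show ?thesis using sum_blocks[of d ?D g, OF d(1) anti gconst] by simp
  next
    case False
    then have "?D (Suc d) = d" using tight by (simp add: durfee_tight_def d_def)
    moreover have "1 \<le> Suc d" by simp
    ultimately show ?thesis
      using sum_blocks[of "Suc d" ?D g, OF _ anti gconst] d(1) False by simp
  qed
  moreover have "{1..?D 1} = {1..d} \<union> {d<..?D 1}" using calculation by auto
  moreover have "(\<Sum>j\<in>{1..d} \<union> {d<..?D 1}. {#g j#}) = (\<Sum>j\<in>{1..d}. {#g j#}) + (\<Sum>j\<in>{d<..?D 1}. {#g j#})"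
    by (rule sum.union_disjoint) auto
  ultimately have "(\<Sum>j\<in>{1..?D 1}. {#g j#}) = (\<Sum>j\<in>{1..d}. {#g j#}) + 
      ((\<Sum>i\<in>{1..<d}. replicate_mset (?D i - ?D (Suc i)) (g (?D i)))
      + (if ?D d \<noteq> d then replicate_mset (?D d - ?D (d + 1)) (g (?D d)) else {#}))"
    by simp
  moreover have "nat (int (?D i) - int (?D (i + 1)) - int 1 + 1) = ?D i - ?D (Suc i)" for i
    by simp
  ultimately show ?thesis
    unfolding ferrers_eigenvalues_def Let_def d_def[symmetric] D1[symmetric]
    by (simp add: g_def ac_simps)
qed

section \<open>The spectrum of a connected threshold hypergraph\<close>

theorem theorem1p5:
  fixes k :: nat and V :: "'a set" and E :: "'a set set"
  assumes "k \<ge> 1"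
    and "connected_threshold_hypergraph k V E"
  shows "(k \<ge> 2 \<or> durfee_tight (block_width (degree_sequence V E)) \<longrightarrow>
            complete_eigenvalue_list V (laplacian E)
              (ferrers_eigenvalues k (column_sum (degree_sequence V E))
                 (block_width (degree_sequence V E)))) \<and>
         (k = 1 \<longrightarrow>
            complete_eigenvalue_list V (laplacian E)
              (ferrers_eigenvalues k (column_sum (degree_sequence V E))
                 (row_length (degree_sequence V E))))"
proof -
  define ds where "ds = degree_sequence V E"
  obtain r n where r: "r \<ge> 1" "n 0 = n 1 + k" and prof: "has_profile k V E r n"
    using connected_has_profile[OF assms(2,1)] by blast
  have p: "profile k r n" using prof by (simp add: has_profile_def)
  have ds: "ds = rev (sorted_list_of_multiset (degree_mset k r n))"
    using prof by (simp add: ds_def degree_sequence_def has_profile_def)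
  have C: "column_sum ds i = size {#x \<in># degree_mset k r n. i \<le> x#}" for i
    by (simp add: column_sum_conv ds)
  have "hypergraph V E"
    using assms(2) unfolding connected_threshold_hypergraph_def
    by (auto intro!: threshold_hypergraph_is_hypergraph[OF assms(1)] threshold_hypergraph.domination)
  then have complete: "complete_eigenvalue_list V (laplacian E) (add_mset 0 (zero_sum_spectrum k r n))"
    using prof size_zero_sum_spectrum[OF assms(1) p]
    by (intro complete_eigenvalue_list_zero_sum) (auto simp: has_profile_def)
  have rows: "ferrers_eigenvalues k (column_sum ds) (row_length ds) = add_mset 0 (zero_sum_spectrum k r n)"
    if "k = 1"
  proof (rule ferrers_eigenvalues_profile[OF p assms(1) r])
    have p1: "profile 1 r n" and ds1: "ds = rev (sorted_list_of_multiset (degree_mset 1 r n))"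
      using p ds that by auto
    show "row_length ds i = n i + i - 1" if "1 \<le> i" "i \<le> r" for i
      using row_length_profile(1)[OF p1 ds1 that] .
    show "row_length ds (Suc r) \<le> r" "row_length ds (Suc r) = r"
      using row_length_profile(2)[OF p1 ds1] by auto
  qed (rule C)
  have blocks: "ferrers_eigenvalues k (column_sum ds) (block_width ds) = add_mset 0 (zero_sum_spectrum k r n)"
    if "k \<ge> 2"
  proof (rule ferrers_eigenvalues_profile[OF p assms(1) r])
    have set: "set ds = set_mset (degree_mset k r n)" by (simp add: ds)
    note block = block_width_profile[OF p that r(1) set]
    show "block_width ds i = n i + i - 1" if "1 \<le> i" "i \<le> r" for i
      using block(1)[OF that] .
    show "block_width ds (Suc r) \<le> r" by (rule block(2))
    show "block_width ds (Suc r) = r" if "n r \<ge> 2" using block(3)[OF that] .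
  qed (rule C)
  have tight: "ferrers_eigenvalues k (column_sum ds) (block_width ds) =
      ferrers_eigenvalues k (column_sum ds) (row_length ds)"
    if k: "k = 1" and t: "durfee_tight (block_width ds)"
  proof -
    have p1: "profile 1 r n" and ds1: "ds = rev (sorted_list_of_multiset (degree_mset 1 r n))"
      using p ds k by auto
    have "durfee (row_length ds) = r"
      using row_length_profile[OF p1 ds1] by (intro durfee_profile[OF p1]) auto
    then have "durfee_tight (row_length ds)"
      using row_length_profile(2)[OF p1 ds1] by (simp add: durfee_tight_def)
    moreover have "r \<in> set ds" using set_degree_mset[OF p1] by (simp add: ds1)
    then have "\<exists>x\<in>set ds. x > 0" using r(1) by (auto simp: Suc_le_eq)
    moreover have "sorted_wrt (\<ge>) ds"
      unfolding ds by (rule sorted_wrt_rev_sorted_list_of_multiset)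
    moreover have "sorted_wrt (\<ge>) (rev (sorted_list_of_set (set ds)))"
      by (rule sorted_wrt_mono_rel[OF _ sorted_wrt_rev_sorted_list_of_set]) simp
    ultimately show ?thesis
      using ferrers_eigenvalues_tight[of ds ds]
        ferrers_eigenvalues_tight[of "rev (sorted_list_of_set (set ds))" ds] t
      unfolding k block_width_def by simp
  qed
  show ?thesis
  proof (cases "k = 1")
    case True
    then show ?thesis using complete rows tight unfolding ds_def by simp
  next
    case False
    then have "k \<ge> 2" using assms(1) by simp
    then show ?thesis using complete blocks unfolding ds_def by simp
  qed
qed

end
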